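(* Let $d\ge1$ be an integer and let $\Omega\subseteq\mathbb{R}^d$ be a locally compact set. The graph of a typical continuous function $f\colon\Omega\to\mathbb{R}$ is $\sigma$-strongly porous in $\mathbb{R}^{d+1}$.
   Context: $C(\Omega)$, the space of continuous real functions on $\Omega$, carries the compact-open topology. A property holds for a typical $f$ if there is a comeager set $\mathcal{F}\subseteq C(\Omega)$ such that every $f\in\mathcal{F}$ has the property. $B(x,r)$ denotes a closed ball. Strong porosity: for a subset $E$ of a metric space $X$, $x\in E$, $r>0$, let $\gamma(E,x,r)=\sup\{s:\exists y\in B(x,r)\ B(y,s)\cap E=\emptyset\}$ (with $\sup\emptyset=0$; balls in $X$) and $\mathsf{por}(E,x)=\limsup_{r\to0}\gamma(E,x,r)/r$. $E$ is strongly porous if $\mathsf{por}(E,x)=1$ for every $x\in E$; $E$ is $\sigma$-strongly porous if it is a countable union of strongly porous sets. Here $X=\mathbb{R}^{d+1}$ with the Euclidean metric. *)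

theory Defs
  imports "HOL-Analysis.Analysis"
begin

(* Functions on Omega are represented by total functions that take the fixed
   value undefined outside Omega, so that two of them are equal as soon as they
   agree on Omega. *)
definition continuous_functions :: "'a::topological_space set \<Rightarrow> ('a \<Rightarrow> real) set" where
  "continuous_functions \<Omega> = {f \<in> extensional \<Omega>. continuous_on \<Omega> f}"

definition compact_open_topology :: "'a::topological_space set \<Rightarrow> ('a \<Rightarrow> real) topology" where
  "compact_open_topology \<Omega> =
     topology_generated_by
       {{f \<in> continuous_functions \<Omega>. f ` K \<subseteq> U} | K U. compact K \<and> K \<subseteq> \<Omega> \<and> open U}"

lemma topspace_compact_open_topology:
  "topspace (compact_open_topology \<Omega>) = continuous_functions \<Omega>"
proof -
  have "continuous_functions \<Omega> = {f \<in> continuous_functions \<Omega>. f ` {} \<subseteq> UNIV}"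
    by simp
  then have "continuous_functions \<Omega> \<in>
      {{f \<in> continuous_functions \<Omega>. f ` K \<subseteq> U} | K U. compact K \<and> K \<subseteq> \<Omega> \<and> open U}"
    by blast
  then show ?thesis
    unfolding compact_open_topology_def topology_generated_by_topspace by blast
qed

definition nowhere_dense_in :: "'a topology \<Rightarrow> 'a set \<Rightarrow> bool" where
  "nowhere_dense_in X S \<longleftrightarrow> S \<subseteq> topspace X \<and> X interior_of (X closure_of S) = {}"

definition meager_in :: "'a topology \<Rightarrow> 'a set \<Rightarrow> bool" where
  "meager_in X S \<longleftrightarrow>
     (\<exists>\<N>. countable \<N> \<and> (\<forall>N\<in>\<N>. nowhere_dense_in X N) \<and> S = \<Union>\<N>)"

definition comeager_in :: "'a topology \<Rightarrow> 'a set \<Rightarrow> bool" where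
  "comeager_in X S \<longleftrightarrow> S \<subseteq> topspace X \<and> meager_in X (topspace X - S)"

definition graph_on :: "'a set \<Rightarrow> ('a \<Rightarrow> 'b) \<Rightarrow> ('a \<times> 'b) set" where
  "graph_on \<Omega> f = {(x, f x) | x. x \<in> \<Omega>}"

(* The radii are required to be positive because the library's cball y s is empty
   for s < 0.  The set is bounded by r whenever x is in E, so the real supremum
   is meaningful there. *)
definition hole_radius :: "'a::metric_space set \<Rightarrow> 'a \<Rightarrow> real \<Rightarrow> real" where
  "hole_radius E x r =
     (let S = {s. 0 < s \<and> (\<exists>y \<in> cball x r. cball y s \<inter> E = {})}
      in if S = {} then 0 else Sup S)"

definition porosity :: "'a::metric_space set \<Rightarrow> 'a \<Rightarrow> ereal" where
  "porosity E x = Limsup (at_right 0) (\<lambda>r. ereal (hole_radius E x r / r))"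

definition strongly_porous :: "'a::metric_space set \<Rightarrow> bool" where
  "strongly_porous E \<longleftrightarrow> (\<forall>x\<in>E. porosity E x = 1)"

definition sigma_strongly_porous :: "'a::metric_space set \<Rightarrow> bool" where
  "sigma_strongly_porous E \<longleftrightarrow>
     (\<exists>P :: nat \<Rightarrow> 'a set. (\<forall>n. strongly_porous (P n)) \<and> E = (\<Union>n. P n))"

end

theory Submission
  imports Defs
begin

text \<open>At a scale below its curvature radius the graph of a polynomial \<open>g\<close> lies close to its
  tangent hyperplane, so a ball of radius almost \<open>r\<close>, centred at distance \<open>r\<close> along the normal,
  misses it; this survives a uniform perturbation of \<open>g\<close> that is small compared with \<open>r\<close>.
  As polynomials are dense, a typical \<open>f\<close> is such a perturbation at arbitrarily small scales on
  each member of a sequence of compact sets exhausting \<open>\<Omega>\<close>.\<close>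

section \<open>Hole radii, porosity and holes beside a nearly flat graph\<close>

text \<open>A ball that misses \<open>E\<close> misses \<open>p\<close> in particular, so its radius
  is smaller than the distance from its centre to \<open>p\<close>, which is at most
  \<open>r\<close>. This bounds the set behind \<open>hole_radius\<close>, so \<open>Sup\<close>
  behaves as a true supremum.\<close>

lemma hole_radius_bounds:
  assumes "p \<in> E" "0 < r"
  shows "hole_radius E p r \<le> r"
    and "\<lbrakk>0 < s; y \<in> cball p r; cball y s \<inter> E = {}\<rbrakk> \<Longrightarrow> s \<le> hole_radius E p r"
proof -
  let ?S = "{s. 0 < s \<and> (\<exists>y \<in> cball p r. cball y s \<inter> E = {})}"
  have le: "s \<le> r" if "s \<in> ?S" for s
  proof -
    obtain y where y: "dist p y \<le> r" "cball y s \<inter> E = {}"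
      using \<open>s \<in> ?S\<close> by auto
    then have "p \<notin> cball y s"
      using assms by blast
    with y show ?thesis
      by (simp add: dist_commute)
  qed
  then have bdd: "bdd_above ?S"
    by (rule bdd_aboveI)
  show "hole_radius E p r \<le> r"
  proof (cases "?S = {}")
    case True
    then show ?thesis using assms by (simp add: hole_radius_def Let_def)
  next
    case False
    have "Sup ?S \<le> r"
      by (rule cSup_least[OF False le])
    with False show ?thesis unfolding hole_radius_def Let_def by presburger
  qed
  show "s \<le> hole_radius E p r" if "0 < s" "y \<in> cball p r" "cball y s \<inter> E = {}"
  proof -
    have "s \<in> ?S" using that by blast
    moreover from this have "?S \<noteq> {}" by blast
    ultimately show ?thesis
      using cSup_upper[OF _ bdd] unfolding hole_radius_def Let_def by presburger
  qed
qed

text \<open>The upper bound on the porosity is automatic because a hole never exceeds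
  \<open>r\<close>. The lower bound concerns a limit superior, so one good radius below each
  \<open>e\<close> is enough; \<open>e\<close> serves both as scale and as relative loss.\<close>

lemma strongly_porousI:
  assumes "\<And>p e. \<lbrakk>p \<in> E; 0 < e; e < 1\<rbrakk> \<Longrightarrow>
             \<exists>r. 0 < r \<and> r < e \<and> r * (1 - e) \<le> hole_radius E p r"
  shows "strongly_porous E"
  unfolding strongly_porous_def
proof
  fix p assume p: "p \<in> E"
  show "porosity E p = 1"
  proof (rule antisym)
    show "porosity E p \<le> 1"
      unfolding porosity_def
    proof (rule Limsup_bounded)
      show "\<forall>\<^sub>F r in at_right 0. ereal (hole_radius E p r / r) \<le> 1"
        using eventually_at_right_less[of "0::real"]
        by eventually_elim (use hole_radius_bounds(1)[OF p] in \<open>simp add: one_ereal_def\<close>)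
    qed
    show "1 \<le> porosity E p"
    proof (rule ccontr)
      assume "\<not> 1 \<le> porosity E p"
      then obtain a :: real where a: "porosity E p < ereal a" "a < 1"
        by (metis ereal_dense2 ereal_less_eq(3) less_ereal.simps(1) not_le one_ereal_def)
      have "\<forall>\<^sub>F r in at_right 0. ereal (hole_radius E p r / r) < ereal a"
        using a(1) unfolding porosity_def by (rule Limsup_lessD)
      then obtain b where b: "0 < b" "\<And>r. \<lbrakk>0 < r; r < b\<rbrakk> \<Longrightarrow> hole_radius E p r / r < a"
        unfolding eventually_at_right_field by auto
      \<comment> \<open>The bound \<open>b\<close> puts the witness \<open>r\<close> in the range
        where the ratio is below \<open>a\<close>, \<open>1 - a\<close> forces the ratio up to
        \<open>a\<close>, and \<open>1/2\<close> keeps \<open>e\<close> below 1.\<close>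
      define e where "e = min (min b (1/2)) (1 - a)"
      have e: "0 < e" "e < 1" "e \<le> b" "e \<le> 1 - a"
        using b a by (auto simp: e_def)
      obtain r where r: "0 < r" "r < e" "r * (1 - e) \<le> hole_radius E p r"
        using assms[OF p e(1,2)] by blast
      have "1 - e \<le> hole_radius E p r / r"
        using r by (simp add: field_simps)
      with b(2)[of r] r e show False by simp
    qed
  qed
qed

text \<open>The hole is centred on the normal at \<open>(x, f x)\<close> to the approximate tangent hyperplane
  of slope \<open>v\<close>.  The condition \<open>2 * r * C \<le> 1\<close> absorbs the curvature term at every distance.\<close>
lemma hole_radius_graph_ge:
  fixes f :: "'a::real_inner \<Rightarrow> real"
  assumes "x \<in> K" and r: "0 < r" "2 * r * C \<le> 1" and e: "0 < e" "e < 1"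
    and approx: "\<And>y. y \<in> K \<Longrightarrow>
      \<bar>f y - f x - v \<bullet> (y - x)\<bar> < C * (norm (y - x))\<^sup>2 + e * r / 2"
  shows "r * (1 - e) \<le> hole_radius (graph_on K f) (x, f x) r"
proof -
  define N where "N = sqrt (1 + (norm v)\<^sup>2)"
  \<comment> \<open>The upward unit normal of the hyperplane of slope \<open>v\<close>.\<close>
  define n where "n = (1 / N) *\<^sub>R (- v, 1 :: real)"
  define c where "c = (x, f x) + r *\<^sub>R n"
  have N: "1 \<le> N" by (simp add: N_def)
  have "norm (- v, 1 :: real) = N" by (simp add: norm_Pair N_def add.commute)
  then have n: "norm n = 1"
    using N unfolding n_def norm_scaleR by simp
  have c: "c \<in> cball (x, f x) r"
    using n r by (simp add: c_def dist_norm)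
  have disj: "cball c (r * (1 - e)) \<inter> graph_on K f = {}"
  proof -
    have "(y, f y) \<notin> cball c (r * (1 - e))" if "y \<in> K" for y
    proof
      assume y: "(y, f y) \<in> cball c (r * (1 - e))"
      define q where "q = (y - x, f y - f x)"
      have "(y, f y) - c = q - r *\<^sub>R n"
        by (simp add: c_def q_def)
      with y have "norm (q - r *\<^sub>R n) \<le> r * (1 - e)"
        by (metis dist_commute dist_norm mem_cball)
      then have "(norm (q - r *\<^sub>R n))\<^sup>2 \<le> (r * (1 - e))\<^sup>2"
        by (rule power_mono) simp
      \<comment> \<open>One factor \<open>1 - e\<close> is given up so that the loss is exactly
        \<open>r\<^sup>2 * e\<close>, which is \<open>2 * r\<close> times the error
        \<open>e * r / 2\<close> in \<open>approx\<close>.\<close>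
      also have "\<dots> \<le> r\<^sup>2 * (1 - e)"
        using r e by (simp add: power_mult_distrib power2_eq_square mult_left_le)
      finally have 1: "(norm (q - r *\<^sub>R n))\<^sup>2 \<le> r\<^sup>2 * (1 - e)" .
      have "(norm (q - r *\<^sub>R n))\<^sup>2 = (norm q)\<^sup>2 - 2 * r * (q \<bullet> n) + r\<^sup>2"
        using n unfolding power2_norm_eq_inner
        by (simp add: inner_diff inner_commute algebra_simps power2_eq_square norm_eq_1)
      moreover have "(norm (y - x))\<^sup>2 \<le> (norm q)\<^sup>2"
        by (simp add: q_def norm_Pair)
      \<comment> \<open>Up to the factor \<open>1 / N\<close>, at most 1, the component of
        \<open>q\<close> along the normal is the deviation of \<open>f\<close> from the
        hyperplane.\<close>
      moreover have "q \<bullet> n < C * (norm (y - x))\<^sup>2 + e * r / 2"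
      proof -
        let ?t = "f y - f x - v \<bullet> (y - x)"
        have "q \<bullet> n = ?t / N"
          by (simp add: q_def n_def inner_commute diff_divide_distrib)
        also have "\<dots> \<le> \<bar>?t\<bar> / N"
          using N by (intro divide_right_mono) auto
        also have "\<dots> \<le> \<bar>?t\<bar>"
          using N mult_left_mono[of 1 N "\<bar>?t\<bar>"] by (simp add: divide_le_eq)
        finally show ?thesis using approx[OF \<open>y \<in> K\<close>] by linarith
      qed
      then have "2 * r * (q \<bullet> n) < 2 * r * (C * (norm (y - x))\<^sup>2 + e * r / 2)"
        using r by simp
      moreover have "2 * r * (C * (norm (y - x))\<^sup>2 + e * r / 2)
          = (2 * r * C) * (norm (y - x))\<^sup>2 + r\<^sup>2 * e"
        by (simp add: algebra_simps power2_eq_square)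
      moreover have "(2 * r * C) * (norm (y - x))\<^sup>2 \<le> (norm (y - x))\<^sup>2"
        using mult_right_mono[OF r(2), of "(norm (y - x))\<^sup>2"] by simp
      moreover have "(norm (q - r *\<^sub>R n))\<^sup>2 \<le> r\<^sup>2 - r\<^sup>2 * e"
        using 1 by (simp add: algebra_simps)
      ultimately show False by linarith
    qed
    then show ?thesis by (auto simp: graph_on_def)
  qed
  show ?thesis
    using hole_radius_bounds(2)[OF _ r(1) _ c disj] r e \<open>x \<in> K\<close> by (auto simp: graph_on_def)
qed

section \<open>A uniform second-order estimate for polynomials\<close>

text \<open>Only the quadratic estimate is used later. The sup bound and the Lipschitz bound
  strengthen the induction, since the product case needs both. The vector \<open>v\<close> plays the
  role of the gradient at \<open>x\<close>, while \<open>C\<close> is uniform over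
  \<open>B\<close>.\<close>

lemma real_polynomial_function_quadratic_bound:
  fixes g :: "'a::euclidean_space \<Rightarrow> real"
  assumes "real_polynomial_function g" "bounded B"
  shows "\<exists>C\<ge>0. \<forall>x\<in>B. \<bar>g x\<bar> \<le> C \<and> (\<exists>v. \<forall>y\<in>B. \<bar>g y - g x\<bar> \<le> C * norm (y - x) \<and>
           \<bar>g y - g x - v \<bullet> (y - x)\<bar> \<le> C * (norm (y - x))\<^sup>2)"
  using assms(1)
proof induction
  case (linear f)
  then interpret bounded_linear f .
  obtain D where D: "D > 0" "\<And>x. norm (f x) \<le> norm x * D"
    using pos_bounded by blast
  obtain R where R: "R > 0" "\<And>x. x \<in> B \<Longrightarrow> norm x \<le> R"
    using assms(2) bounded_pos by blast
  show ?case
  \<comment> \<open>\<open>D\<close> is a Lipschitz constant and \<open>R * D\<close> bounds the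
    values on \<open>B\<close>; the quadratic remainder vanishes.\<close>
  proof (intro exI[of _ "D + R * D"] conjI ballI)
    show "0 \<le> D + R * D" using D R by simp
    fix x assume "x \<in> B"
    then have "\<bar>f x\<bar> \<le> R * D"
      using order_trans[OF D(2)[of x] mult_right_mono[OF R(2)]] D(1) by simp
    then show "\<bar>f x\<bar> \<le> D + R * D" using D by simp
    \<comment> \<open>\<open>adjoint f 1\<close> is the Riesz representative of the functional
      \<open>f\<close>.\<close>
    have f: "f z = adjoint f 1 \<bullet> z" for z
      using adjoint_works[OF linear_axioms, of z 1] by (simp add: inner_commute)
    show "\<exists>v. \<forall>y\<in>B. \<bar>f y - f x\<bar> \<le> (D + R * D) * norm (y - x) \<and>
           \<bar>f y - f x - v \<bullet> (y - x)\<bar> \<le> (D + R * D) * (norm (y - x))\<^sup>2"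
    proof (intro exI[of _ "adjoint f 1"] ballI conjI)
      fix y
      have "\<bar>f y - f x\<bar> \<le> D * norm (y - x)"
        using D(2)[of "y - x"] by (simp add: diff mult.commute)
      also have "\<dots> \<le> (D + R * D) * norm (y - x)"
        using D R by (intro mult_right_mono) auto
      finally show "\<bar>f y - f x\<bar> \<le> (D + R * D) * norm (y - x)" .
      show "\<bar>f y - f x - adjoint f 1 \<bullet> (y - x)\<bar> \<le> (D + R * D) * (norm (y - x))\<^sup>2"
        using D R by (simp add: diff f[symmetric])
    qed
  qed
next
  case (const c)
  show ?case
    by (rule exI[of _ "\<bar>c\<bar>"]) (auto intro!: exI[of _ 0])
next
  case (add g h)
  then obtain C D where CD: "0 \<le> C" "0 \<le> D" and
    C: "\<forall>x\<in>B. \<bar>g x\<bar> \<le> C \<and> (\<exists>v. \<forall>y\<in>B. \<bar>g y - g x\<bar> \<le> C * norm (y - x) \<and>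
           \<bar>g y - g x - v \<bullet> (y - x)\<bar> \<le> C * (norm (y - x))\<^sup>2)" and
    D: "\<forall>x\<in>B. \<bar>h x\<bar> \<le> D \<and> (\<exists>v. \<forall>y\<in>B. \<bar>h y - h x\<bar> \<le> D * norm (y - x) \<and>
           \<bar>h y - h x - v \<bullet> (y - x)\<bar> \<le> D * (norm (y - x))\<^sup>2)"
    by blast
  show ?case
  proof (intro exI[of _ "C + D"] conjI ballI)
    show "0 \<le> C + D" using CD by simp
    fix x assume x: "x \<in> B"
    show "\<bar>g x + h x\<bar> \<le> C + D" using C D x by (smt (verit))
    obtain v w where
      v: "\<forall>y\<in>B. \<bar>g y - g x\<bar> \<le> C * norm (y - x) \<and>
           \<bar>g y - g x - v \<bullet> (y - x)\<bar> \<le> C * (norm (y - x))\<^sup>2" and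
      w: "\<forall>y\<in>B. \<bar>h y - h x\<bar> \<le> D * norm (y - x) \<and>
           \<bar>h y - h x - w \<bullet> (y - x)\<bar> \<le> D * (norm (y - x))\<^sup>2"
      using C D x by blast
    show "\<exists>v. \<forall>y\<in>B. \<bar>g y + h y - (g x + h x)\<bar> \<le> (C + D) * norm (y - x) \<and>
           \<bar>g y + h y - (g x + h x) - v \<bullet> (y - x)\<bar> \<le> (C + D) * (norm (y - x))\<^sup>2"
    proof (intro exI[of _ "v + w"] ballI)
      fix y assume "y \<in> B"
      then have *: "\<bar>g y - g x\<bar> \<le> C * norm (y - x)" "\<bar>h y - h x\<bar> \<le> D * norm (y - x)"
        "\<bar>g y - g x - v \<bullet> (y - x)\<bar> \<le> C * (norm (y - x))\<^sup>2"
        "\<bar>h y - h x - w \<bullet> (y - x)\<bar> \<le> D * (norm (y - x))\<^sup>2"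
        using v w by auto
      show "\<bar>g y + h y - (g x + h x)\<bar> \<le> (C + D) * norm (y - x) \<and>
           \<bar>g y + h y - (g x + h x) - (v + w) \<bullet> (y - x)\<bar> \<le> (C + D) * (norm (y - x))\<^sup>2"
        unfolding distrib_right inner_add_left using * by linarith
    qed
  qed
next
  case (mult g h)
  then obtain C D where CD: "0 \<le> C" "0 \<le> D" and
    C: "\<forall>x\<in>B. \<bar>g x\<bar> \<le> C \<and> (\<exists>v. \<forall>y\<in>B. \<bar>g y - g x\<bar> \<le> C * norm (y - x) \<and>
           \<bar>g y - g x - v \<bullet> (y - x)\<bar> \<le> C * (norm (y - x))\<^sup>2)" and
    D: "\<forall>x\<in>B. \<bar>h x\<bar> \<le> D \<and> (\<exists>v. \<forall>y\<in>B. \<bar>h y - h x\<bar> \<le> D * norm (y - x) \<and>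
           \<bar>h y - h x - v \<bullet> (y - x)\<bar> \<le> D * (norm (y - x))\<^sup>2)"
    by blast
  show ?case
  \<comment> \<open>The remainder of a product has three terms, each at most \<open>C * D\<close>
    times the squared distance.\<close>
  proof (intro exI[of _ "3 * (C * D)"] conjI ballI)
    have CD0: "0 \<le> C * D" using CD by simp
    then show "0 \<le> 3 * (C * D)" by simp
    fix x assume x: "x \<in> B"
    have gh: "\<bar>g z\<bar> \<le> C" "\<bar>h z\<bar> \<le> D" if "z \<in> B" for z
      using that C D by auto
    have "\<bar>g x * h x\<bar> \<le> C * D"
      unfolding abs_mult using gh[OF x] CD by (intro mult_mono) auto
    then show "\<bar>g x * h x\<bar> \<le> 3 * (C * D)"
      using CD0 by linarith
    obtain v w where
      v: "\<forall>y\<in>B. \<bar>g y - g x\<bar> \<le> C * norm (y - x) \<and>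
           \<bar>g y - g x - v \<bullet> (y - x)\<bar> \<le> C * (norm (y - x))\<^sup>2" and
      w: "\<forall>y\<in>B. \<bar>h y - h x\<bar> \<le> D * norm (y - x) \<and>
           \<bar>h y - h x - w \<bullet> (y - x)\<bar> \<le> D * (norm (y - x))\<^sup>2"
      using C D x by blast
    show "\<exists>v. \<forall>y\<in>B. \<bar>g y * h y - g x * h x\<bar> \<le> 3 * (C * D) * norm (y - x) \<and>
           \<bar>g y * h y - g x * h x - v \<bullet> (y - x)\<bar> \<le> 3 * (C * D) * (norm (y - x))\<^sup>2"
    proof (intro exI[of _ "g x *\<^sub>R w + h x *\<^sub>R v"] ballI conjI)
      fix y assume y: "y \<in> B"
      define d where "d = norm (y - x)"
      define a where "a = g y - g x - v \<bullet> (y - x)"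
      define b where "b = h y - h x - w \<bullet> (y - x)"
      have d: "0 \<le> d" by (simp add: d_def)
      have *: "\<bar>g y - g x\<bar> \<le> C * d" "\<bar>h y - h x\<bar> \<le> D * d" "\<bar>a\<bar> \<le> C * d\<^sup>2" "\<bar>b\<bar> \<le> D * d\<^sup>2"
        using v w y by (auto simp: d_def a_def b_def)
      have "\<bar>g y * (h y - h x)\<bar> \<le> C * (D * d)" "\<bar>h x * (g y - g x)\<bar> \<le> D * (C * d)"
        unfolding abs_mult using gh x y * CD d by (auto intro!: mult_mono)
      moreover have "g y * h y - g x * h x = g y * (h y - h x) + h x * (g y - g x)"
        by (simp add: algebra_simps)
      moreover have "3 * (C * D) * d = C * (D * d) + D * (C * d) + C * D * d"
        by (simp add: algebra_simps)
      moreover have "0 \<le> C * D * d" using CD d by simp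
      ultimately show "\<bar>g y * h y - g x * h x\<bar> \<le> 3 * (C * D) * norm (y - x)"
        unfolding d_def[symmetric] by linarith
      have "\<bar>g x * b\<bar> \<le> C * (D * d\<^sup>2)" "\<bar>h x * a\<bar> \<le> D * (C * d\<^sup>2)"
        "\<bar>(g y - g x) * (h y - h x)\<bar> \<le> (C * d) * (D * d)"
        unfolding abs_mult using gh x y * CD d by (auto intro!: mult_mono)
      \<comment> \<open>The product rule with exact remainder; the last product is of second order
        because both factors are Lipschitz.\<close>
      moreover have "g y * h y - g x * h x - (g x *\<^sub>R w + h x *\<^sub>R v) \<bullet> (y - x)
          = g x * b + h x * a + (g y - g x) * (h y - h x)"
        unfolding a_def b_def inner_add_left inner_scaleR_left by (simp add: algebra_simps)
      moreover have "3 * (C * D) * d\<^sup>2 = C * (D * d\<^sup>2) + D * (C * d\<^sup>2) + (C * d) * (D * d)"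
        by (simp add: algebra_simps power2_eq_square)
      ultimately show "\<bar>g y * h y - g x * h x - (g x *\<^sub>R w + h x *\<^sub>R v) \<bullet> (y - x)\<bar>
          \<le> 3 * (C * D) * (norm (y - x))\<^sup>2"
        unfolding d_def[symmetric] by linarith
    qed
  qed
qed

section \<open>Uniform closeness on compact sets and the compact-open topology\<close>

text \<open>By uniform continuity \<open>K\<close> is covered by finitely many compact pieces on
  which \<open>f\<close> stays within \<open>e/2\<close> of its value at a centre. Finitely many
  subbasic conditions, one per piece, then control \<open>h\<close> on all of
  \<open>K\<close>.\<close>

lemma compact_open_nhd_uniform:
  fixes \<Omega> :: "'a::metric_space set"
  assumes f: "f \<in> continuous_functions \<Omega>" and K: "compact K" "K \<subseteq> \<Omega>" and e: "0 < e"
  shows "\<exists>N. openin (compact_open_topology \<Omega>) N \<and> f \<in> N \<and> (\<forall>h\<in>N. \<forall>x\<in>K. \<bar>h x - f x\<bar> < e)"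
proof -
  have "continuous_on K f"
    using f K continuous_on_subset by (auto simp: continuous_functions_def)
  then have "uniformly_continuous_on K f"
    using K compact_uniformly_continuous by blast
  then obtain r where r: "0 < r"
    and fr: "\<And>x y. \<lbrakk>x \<in> K; y \<in> K; dist y x < r\<rbrakk> \<Longrightarrow> dist (f y) (f x) < e / 2"
    using e unfolding uniformly_continuous_on_def by (metis half_gt_zero)
  obtain T where T: "finite T" "T \<subseteq> K" "K \<subseteq> (\<Union>x\<in>T. ball x (r/2))"
  proof (rule compactE_image[OF K(1)])
    show "K \<subseteq> (\<Union>x\<in>K. ball x (r/2))" using r by auto
  qed auto
  \<comment> \<open>Closed balls keep the pieces compact, and radius \<open>r/2\<close> keeps them
    within the modulus \<open>r\<close>.\<close>
  define A where "A x = {h \<in> continuous_functions \<Omega>. h ` (K \<inter> cball x (r/2)) \<subseteq> ball (f x) (e/2)}" for x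
  \<comment> \<open>The explicit factor \<open>continuous_functions \<Omega>\<close> matters when
    \<open>T\<close> is empty, where the intersection alone would be \<open>UNIV\<close>.\<close>
  define N where "N = continuous_functions \<Omega> \<inter> (\<Inter>x\<in>T. A x)"
  have A: "openin (compact_open_topology \<Omega>) (A x)" for x
    unfolding A_def compact_open_topology_def
    by (rule topology_generated_by_Basis) (use K in \<open>blast intro: compact_Int_closed\<close>)
  have "openin (compact_open_topology \<Omega>) N"
    unfolding N_def topspace_compact_open_topology[symmetric]
    using T(1) A by (intro openin_Int_Inter) auto
  moreover have "f \<in> A x" if "x \<in> T" for x
  proof -
    have "f y \<in> ball (f x) (e/2)" if "y \<in> K \<inter> cball x (r/2)" for y
      using fr[of x y] that \<open>x \<in> T\<close> T(2) r by (auto simp: dist_commute)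
    then show ?thesis using f by (auto simp: A_def)
  qed
  then have "f \<in> N" using f by (auto simp: N_def)
  moreover have "\<bar>h x - f x\<bar> < e" if h: "h \<in> N" and x: "x \<in> K" for h x
  proof -
    obtain t where t: "t \<in> T" "x \<in> ball t (r/2)" using T x by blast
    then have "h x \<in> ball (f t) (e/2)"
      using h x by (fastforce simp: N_def A_def)
    moreover have "dist (f x) (f t) < e / 2"
      using fr[of t x] t x T r by (auto simp: dist_commute)
    ultimately show ?thesis
      unfolding mem_ball dist_real_def by linarith
  qed
  ultimately show ?thesis by blast
qed

text \<open>The converse direction, by induction on the generation of open sets. For a subbasic set,
  the compact image of \<open>K\<close> has a uniform margin inside \<open>U\<close>; a finite
  intersection takes the union of the compact sets and the smaller tolerance.\<close>

lemma openin_compact_open_uniform: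
  fixes \<Omega> :: "'a::metric_space set"
  assumes "openin (compact_open_topology \<Omega>) W" "f \<in> W"
  shows "\<exists>K e. compact K \<and> K \<subseteq> \<Omega> \<and> 0 < e \<and>
           (\<forall>h \<in> continuous_functions \<Omega>. (\<forall>x\<in>K. \<bar>h x - f x\<bar> < e) \<longrightarrow> h \<in> W)"
  using assms(1)[unfolded compact_open_topology_def openin_topology_generated_by_iff] assms(2)
proof induction
  case Empty
  then show ?case by simp
next
  case (Int A B)
  then obtain K e L d where *: "compact K" "K \<subseteq> \<Omega>" "0 < e" "compact L" "L \<subseteq> \<Omega>" "0 < d"
    "\<forall>h \<in> continuous_functions \<Omega>. (\<forall>x\<in>K. \<bar>h x - f x\<bar> < e) \<longrightarrow> h \<in> A"
    "\<forall>h \<in> continuous_functions \<Omega>. (\<forall>x\<in>L. \<bar>h x - f x\<bar> < d) \<longrightarrow> h \<in> B"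
    by blast
  then show ?case
    by (intro exI[of _ "K \<union> L"] exI[of _ "min e d"]) (auto intro: compact_Un)
next
  case (UN \<K>)
  then obtain A where A: "A \<in> \<K>" "f \<in> A" by blast
  show ?case using UN.IH[OF A] A(1) by blast
next
  case (Basis S)
  then obtain K U where S: "S = {f \<in> continuous_functions \<Omega>. f ` K \<subseteq> U}"
    and K: "compact K" "K \<subseteq> \<Omega>" and U: "open U"
    by blast
  have "continuous_on K f"
    using Basis.prems K continuous_on_subset by (auto simp: S continuous_functions_def)
  then have "compact (f ` K)" using K compact_continuous_image by blast
  moreover have "f ` K \<subseteq> U" using Basis.prems by (simp add: S)
  ultimately obtain e where e: "0 < e" "(\<Union>y\<in>f ` K. ball y e) \<subseteq> U"
    using U compact_subset_open_imp_ball_epsilon_subset by metis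
  have "h \<in> S" if "h \<in> continuous_functions \<Omega>" "\<forall>x\<in>K. \<bar>h x - f x\<bar> < e" for h
  proof -
    have "h x \<in> U" if "x \<in> K" for x
    proof -
      have "h x \<in> ball (f x) e"
        using \<open>\<forall>x\<in>K. \<bar>h x - f x\<bar> < e\<close> that by (auto simp: dist_real_def abs_minus_commute)
      then show ?thesis using e that by blast
    qed
    then show ?thesis using that(1) by (auto simp: S)
  qed
  then show ?case using K e(1) by blast
qed

text \<open>A continuous function attains its maximum on a nonempty compact set, so the strict
  inequality leaves a uniform slack \<open>e\<close>, and any \<open>h\<close> within
  \<open>e\<close> of \<open>f\<close> on \<open>K\<close> stays in the tube.\<close>

lemma openin_uniform_tube:
  fixes \<Omega> :: "'a::metric_space set"
  assumes K: "compact K" "K \<subseteq> \<Omega>" and g: "continuous_on K g"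
  shows "openin (compact_open_topology \<Omega>)
           {f \<in> continuous_functions \<Omega>. \<forall>x\<in>K. \<bar>f x - g x\<bar> < d}"
    (is "openin ?X ?S")
proof (subst openin_subopen, intro ballI)
  fix f assume f: "f \<in> ?S"
  then have fK: "continuous_on K f"
    using K continuous_on_subset by (auto simp: continuous_functions_def)
  have "\<exists>e>0. \<forall>x\<in>K. \<bar>f x - g x\<bar> + e \<le> d"
  proof (cases "K = {}")
    case True
    then show ?thesis by (auto intro: exI[of _ 1])
  next
    case False
    have "continuous_on K (\<lambda>x. \<bar>f x - g x\<bar>)"
      using fK g by (intro continuous_intros)
    then obtain z where z: "z \<in> K" "\<forall>x\<in>K. \<bar>f x - g x\<bar> \<le> \<bar>f z - g z\<bar>"
      using continuous_attains_sup[OF K(1) False] by blast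
    then show ?thesis
      using f by (intro exI[of _ "d - \<bar>f z - g z\<bar>"]) auto
  qed
  then obtain e where e: "0 < e" "\<And>x. x \<in> K \<Longrightarrow> \<bar>f x - g x\<bar> + e \<le> d"
    by blast
  obtain N where N: "openin ?X N" "f \<in> N" "\<forall>h\<in>N. \<forall>x\<in>K. \<bar>h x - f x\<bar> < e"
    using compact_open_nhd_uniform[OF _ K e(1)] f by blast
  have "N \<subseteq> ?S"
  proof
    fix h assume h: "h \<in> N"
    then have "h \<in> continuous_functions \<Omega>"
      using openin_subset[OF N(1)] by (auto simp: topspace_compact_open_topology)
    moreover have "\<bar>h x - g x\<bar> < d" if "x \<in> K" for x
      using N(3) h e(2)[OF that] that by (smt (verit))
    ultimately show "h \<in> ?S" by blast
  qed
  with N show "\<exists>T. openin ?X T \<and> f \<in> T \<and> T \<subseteq> ?S" by blast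
qed

text \<open>Membership in \<open>W\<close> is secured by closeness to \<open>f\<close> on one
  compact set, where Stone-Weierstrass applies. \<open>restrict\<close> makes the polynomial an
  element of the function space, whose members are extensional.\<close>

lemma polynomials_dense_compact_open:
  fixes \<Omega> :: "'a::euclidean_space set"
  assumes W: "openin (compact_open_topology \<Omega>) W" "W \<noteq> {}"
  shows "\<exists>g. real_polynomial_function g \<and> restrict g \<Omega> \<in> W"
proof -
  obtain f where f: "f \<in> W" using W by blast
  then have fc: "continuous_on \<Omega> f"
    using openin_subset[OF W(1)]
    by (auto simp: topspace_compact_open_topology continuous_functions_def)
  obtain K e where K: "compact K" "K \<subseteq> \<Omega>" and e: "0 < e"
    and *: "\<forall>h \<in> continuous_functions \<Omega>. (\<forall>x\<in>K. \<bar>h x - f x\<bar> < e) \<longrightarrow> h \<in> W"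
    using openin_compact_open_uniform[OF W(1) f] by blast
  obtain g where g: "polynomial_function g" "\<And>x. x \<in> K \<Longrightarrow> norm (f x - g x) < e"
    using Stone_Weierstrass_polynomial_function[OF K(1) continuous_on_subset[OF fc K(2)] e]
    by metis
  have "restrict g \<Omega> \<in> continuous_functions \<Omega>"
    using g(1) by (auto simp: continuous_functions_def intro: continuous_on_polymonial_function
        cong: continuous_on_cong)
  moreover have "\<bar>restrict g \<Omega> x - f x\<bar> < e" if "x \<in> K" for x
    using g(2)[OF that] K(2) that by (auto simp: abs_minus_commute)
  ultimately have "restrict g \<Omega> \<in> W" using * by blast
  with g(1) show ?thesis by (auto simp: real_polynomial_function_eq)
qed

section \<open>Countable intersections of dense open sets and compact exhaustion\<close>

text \<open>The complement of a dense open set is closed with empty interior, hence nowhere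
  dense.\<close>

lemma comeager_in_INT:
  assumes "\<And>n::nat. openin X (U n)"
    and "\<And>n W. \<lbrakk>openin X W; W \<noteq> {}\<rbrakk> \<Longrightarrow> U n \<inter> W \<noteq> {}"
  shows "comeager_in X (\<Inter>n. U n)"
proof -
  have "nowhere_dense_in X (topspace X - U n)" for n
  proof -
    have "closedin X (topspace X - U n)" using assms(1) by blast
    moreover have "X interior_of (topspace X - U n) = {}"
      using assms(2)[of "X interior_of (topspace X - U n)" n] interior_of_subset[of X "topspace X - U n"]
      by auto
    ultimately show ?thesis by (simp add: nowhere_dense_in_def closure_of_closedin)
  qed
  moreover have "(\<Inter>n. U n) \<subseteq> topspace X"
    using openin_subset[OF assms(1)] by blast
  moreover have "topspace X - (\<Inter>n. U n) = \<Union> (range (\<lambda>n. topspace X - U n))"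
    by blast
  ultimately show ?thesis
    unfolding comeager_in_def meager_in_def
    by (intro conjI exI[of _ "range (\<lambda>n. topspace X - U n)"]) auto
qed

text \<open>A locally compact set is the intersection of a closed and an open set, and an open set
  is a countable union of compact sets.\<close>

lemma locally_compact_countable_Union_compact:
  fixes \<Omega> :: "'a::euclidean_space set"
  assumes "locally compact \<Omega>"
  shows "\<exists>K :: nat \<Rightarrow> 'a set. (\<forall>n. compact (K n)) \<and> \<Omega> = (\<Union>n. K n)"
proof -
  obtain C V where C: "closed C" and V: "open V" and \<Omega>: "\<Omega> = C \<inter> V"
    using assms locally_compact_closed_Int_open by metis
  obtain L where L: "\<And>n::nat. compact (L n)" "\<Union> (range L) = V"
    using open_Union_compact_subsets[OF V] by metis
  then have "\<forall>n. compact (C \<inter> L n)" "\<Omega> = (\<Union>n. C \<inter> L n)"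
    using C \<Omega> by (auto simp: closed_Int_compact)
  then show ?thesis by (intro exI[of _ "\<lambda>n. C \<inter> L n"] conjI)
qed

section \<open>Functions close to a polynomial at a small scale, and the typical function\<close>

text \<open>The tolerance \<open>e * r / 4\<close> is half the error allowed in
  \<open>hole_radius_graph_ge\<close>, since replacing \<open>g\<close> by \<open>f\<close> costs it
  at \<open>x\<close> and again at \<open>y\<close>. The strict inequality makes the condition open
  in \<open>f\<close>.\<close>

definition polynomially_flat :: "'a::euclidean_space set \<Rightarrow> real \<Rightarrow> ('a \<Rightarrow> real) \<Rightarrow> bool" where
  "polynomially_flat K e f \<longleftrightarrow>
     (\<exists>g r C. real_polynomial_function g \<and> 0 < r \<and> r < e \<and> 2 * r * C \<le> 1 \<and>
        (\<forall>x\<in>K. \<exists>v. \<forall>y\<in>K. \<bar>g y - g x - v \<bullet> (y - x)\<bar> \<le> C * (norm (y - x))\<^sup>2) \<and>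
        (\<forall>x\<in>K. \<bar>f x - g x\<bar> < e * r / 4))"

text \<open>For fixed witnesses \<open>g\<close>, \<open>r\<close>, \<open>C\<close> only the last
  condition mentions \<open>f\<close>, and it describes an open tube around
  \<open>g\<close>.\<close>

lemma openin_polynomially_flat:
  fixes \<Omega> :: "'a::euclidean_space set"
  assumes "compact K" "K \<subseteq> \<Omega>"
  shows "openin (compact_open_topology \<Omega>) {f \<in> continuous_functions \<Omega>. polynomially_flat K e f}"
    (is "openin ?X ?S")
proof (subst openin_subopen, intro ballI)
  fix f assume f: "f \<in> ?S"
  then obtain g r C where *: "real_polynomial_function g" "0 < r" "r < e" "2 * r * C \<le> 1"
    "\<forall>x\<in>K. \<exists>v. \<forall>y\<in>K. \<bar>g y - g x - v \<bullet> (y - x)\<bar> \<le> C * (norm (y - x))\<^sup>2"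
    "\<forall>x\<in>K. \<bar>f x - g x\<bar> < e * r / 4"
    unfolding polynomially_flat_def by blast
  let ?T = "{f \<in> continuous_functions \<Omega>. \<forall>x\<in>K. \<bar>f x - g x\<bar> < e * r / 4}"
  have "continuous_on K g"
    using *(1) continuous_on_polymonial_function real_polynomial_function_eq by blast
  then have "openin ?X ?T" by (rule openin_uniform_tube[OF assms])
  moreover have "f \<in> ?T" using f *(6) by blast
  moreover have "?T \<subseteq> ?S"
    using *(1-5) unfolding polynomially_flat_def by blast
  ultimately show "\<exists>T. openin ?X T \<and> f \<in> T \<and> T \<subseteq> ?S" by blast
qed

lemma polynomially_flat_restrict_polynomial:
  fixes \<Omega> :: "'a::euclidean_space set"
  assumes K: "compact K" "K \<subseteq> \<Omega>" and g: "real_polynomial_function g" and e: "0 < e"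
  shows "polynomially_flat K e (restrict g \<Omega>)"
proof -
  obtain C where C: "0 \<le> C"
    "\<forall>x\<in>K. \<exists>v. \<forall>y\<in>K. \<bar>g y - g x - v \<bullet> (y - x)\<bar> \<le> C * (norm (y - x))\<^sup>2"
    using real_polynomial_function_quadratic_bound[OF g compact_imp_bounded[OF K(1)]] by metis
  \<comment> \<open>The first term gives \<open>r < e\<close>, the second
    \<open>2 * r * C \<le> 1\<close>; the added 1 keeps the denominator positive when
    \<open>C = 0\<close>.\<close>
  define r where "r = min (e / 2) (1 / (2 * C + 1))"
  have "r \<le> 1 / (2 * C + 1)" by (simp add: r_def)
  then have "r * (2 * C + 1) \<le> 1" using C(1) by (simp add: field_simps)
  moreover have r: "0 < r" "r < e" using e C(1) by (auto simp: r_def)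
  ultimately have "2 * r * C \<le> 1" by (simp add: algebra_simps)
  then show ?thesis
    unfolding polynomially_flat_def using g r C(2) e K(2)
    by (intro exI[of _ g] exI[of _ r] exI[of _ C]) auto
qed

lemma polynomially_flat_hole:
  fixes f :: "'a::euclidean_space \<Rightarrow> real"
  assumes "polynomially_flat K e f" "0 < e" "e < 1" "x \<in> K"
  shows "\<exists>r. 0 < r \<and> r < e \<and> r * (1 - e) \<le> hole_radius (graph_on K f) (x, f x) r"
proof -
  obtain g r C where *: "0 < r" "r < e" "2 * r * C \<le> 1"
    "\<forall>x\<in>K. \<exists>v. \<forall>y\<in>K. \<bar>g y - g x - v \<bullet> (y - x)\<bar> \<le> C * (norm (y - x))\<^sup>2"
    "\<forall>x\<in>K. \<bar>f x - g x\<bar> < e * r / 4"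
    using assms(1) unfolding polynomially_flat_def by blast
  obtain v where v: "\<forall>y\<in>K. \<bar>g y - g x - v \<bullet> (y - x)\<bar> \<le> C * (norm (y - x))\<^sup>2"
    using *(4) assms(4) by blast
  have "\<bar>f y - f x - v \<bullet> (y - x)\<bar> < C * (norm (y - x))\<^sup>2 + e * r / 2" if "y \<in> K" for y
  proof -
    have "\<bar>g y - g x - v \<bullet> (y - x)\<bar> \<le> C * (norm (y - x))\<^sup>2"
      "\<bar>f y - g y\<bar> < e * r / 4" "\<bar>f x - g x\<bar> < e * r / 4"
      using v *(5) that assms(4) by auto
    then show ?thesis by linarith
  qed
  from hole_radius_graph_ge[OF assms(4) *(1,3) assms(2,3) this] * show ?thesis by blast
qed

text \<open>Flatness at the tolerances 1/(m+1) reaches every \<open>e\<close>, so countably many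
  open conditions suffice.\<close>

lemma strongly_porous_graph_on:
  fixes f :: "'a::euclidean_space \<Rightarrow> real"
  assumes "\<And>m. polynomially_flat K (inverse (real (Suc m))) f"
  shows "strongly_porous (graph_on K f)"
proof (rule strongly_porousI)
  fix p and e :: real assume p: "p \<in> graph_on K f" and e: "0 < e" "e < 1"
  then obtain x where x: "x \<in> K" "p = (x, f x)" by (auto simp: graph_on_def)
  obtain m where m: "inverse (real (Suc m)) < e" using reals_Archimedean[OF e(1)] by blast
  let ?d = "inverse (real (Suc m))"
  have "0 < ?d" "?d < 1" using m e by auto
  then obtain r where r: "0 < r" "r < ?d" "r * (1 - ?d) \<le> hole_radius (graph_on K f) p r"
    using polynomially_flat_hole[OF assms _ _ x(1)] x(2) by blast
  have "r * (1 - e) \<le> r * (1 - ?d)" using r m by (intro mult_left_mono) auto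
  with r(3) have "r * (1 - e) \<le> hole_radius (graph_on K f) p r"
    by (rule order_trans[rotated])
  with r(1,2) m show "\<exists>r. 0 < r \<and> r < e \<and> r * (1 - e) \<le> hole_radius (graph_on K f) p r"
    by (meson less_trans)
qed

(* The library's metric on (real ^ 'n) \<times> real is the Euclidean one,
   dist (a, s) (b, t) = sqrt ((dist a b)^2 + (dist s t)^2). *)
theorem theorem1p5:
  fixes \<Omega> :: "(real ^ 'n) set"
  assumes "locally compact \<Omega>"
  shows "\<exists>\<F>. comeager_in (compact_open_topology \<Omega>) \<F> \<and>
           (\<forall>f\<in>\<F>. sigma_strongly_porous (graph_on \<Omega> f))"
proof -
  let ?X = "compact_open_topology \<Omega>"
  obtain K :: "nat \<Rightarrow> (real ^ 'n) set" where K: "\<And>n. compact (K n)" and \<Omega>: "\<Omega> = (\<Union>n. K n)"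
    using locally_compact_countable_Union_compact[OF assms] by blast
  have K\<Omega>: "K n \<subseteq> \<Omega>" for n using \<Omega> by blast
  define U where "U n m = {f \<in> continuous_functions \<Omega>.
    polynomially_flat (K n) (inverse (real (Suc m))) f}" for n m
  \<comment> \<open>Pairs (compact piece, tolerance) are coded by one natural number to match
    \<open>comeager_in_INT\<close>.\<close>
  define V where "V k = U (fst (prod_decode k)) (snd (prod_decode k))" for k
  have "openin ?X (V k)" for k
    unfolding V_def U_def using openin_polynomially_flat[OF K K\<Omega>] .
  moreover have "V k \<inter> W \<noteq> {}" if W: "openin ?X W" "W \<noteq> {}" for k W
  proof -
    obtain g where g: "real_polynomial_function g" "restrict g \<Omega> \<in> W"
      using polynomials_dense_compact_open[OF W] by blast
    then have "restrict g \<Omega> \<in> continuous_functions \<Omega>"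
      using openin_subset[OF W(1)] by (auto simp: topspace_compact_open_topology)
    \<comment> \<open>A restricted polynomial is flat on every piece at every tolerance, so density
      of polynomials makes each \<open>V k\<close> dense.\<close>
    then have "restrict g \<Omega> \<in> V k"
      unfolding V_def U_def using polynomially_flat_restrict_polynomial[OF K K\<Omega> g(1)] by simp
    with g(2) show ?thesis by blast
  qed
  ultimately have "comeager_in ?X (\<Inter>k. V k)" by (rule comeager_in_INT)
  moreover have "sigma_strongly_porous (graph_on \<Omega> f)" if f: "f \<in> (\<Inter>k. V k)" for f
  proof -
    have "f \<in> U n m" for n m
      using f INT_D[of f V UNIV "prod_encode (n, m)"] by (simp add: V_def)
    then have "strongly_porous (graph_on (K n) f)" for n
      by (intro strongly_porous_graph_on) (simp add: U_def)
    moreover have "graph_on \<Omega> f = (\<Union>n. graph_on (K n) f)"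
      using \<Omega> by (auto simp: graph_on_def)
    ultimately show ?thesis
      unfolding sigma_strongly_porous_def by (intro exI[of _ "\<lambda>n. graph_on (K n) f"]) simp
  qed
  ultimately show ?thesis by blast
qed

end
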